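(* Let $G=(V,E)$ be a simple graph on $n$ vertices with at least one edge, with minimum degree $\delta$, and let $0=\mu_1\le\mu_2\le\cdots\le\mu_n$ be the eigenvalues of its Laplacian matrix. Then \[ t(G)\ge \frac{\mu_n\mu_2}{n(\mu_n-\delta)} \qquad\text{and}\qquad t(G)\ge \frac{\mu_2}{\mu_n-\mu_2}. \]
   Context: The Laplacian matrix of $G$ is $L=D-A$, where $D$ is the diagonal matrix of vertex degrees and $A$ is the adjacency matrix; $\mu_i$ denotes its $i$-th smallest eigenvalue. The toughness of $G$ is $t(G)=\min\{|S|/c(G-S)\}$, the minimum over all proper subsets $S\subset V$ with $c(G-S)>1$, where $c(G-S)$ is the number of connected components of the subgraph induced on $V\setminus S$; by convention a complete graph has $t(G)=\infty$. *)

theory Defs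
  imports
    "Graph_Theory.Graph_Theory"
    "Jordan_Normal_Form.Char_Poly"
    "HOL-Library.Extended_Real"
begin

text \<open>
  A finite simple graph is an instance of the locale \<^locale>\<open>graph\<close>: a finite, loop-free
  digraph without parallel arcs whose arc relation is symmetric. An undirected edge is a pair of
  opposite arcs, so the degree of a vertex is its out-degree, and the strongly connected components
  of such a digraph are the connected components of the undirected graph.
\<close>

definition min_degree :: "('a, 'b) pre_digraph \<Rightarrow> nat" where
  "min_degree G = Min (out_degree G ` verts G)"

text \<open>
  The matrices are taken with respect to a list \<open>vs\<close> enumerating the vertices without repetition.
\<close>

definition degree_mat :: "'a list \<Rightarrow> ('a, 'b) pre_digraph \<Rightarrow> real mat" where
  "degree_mat vs G = mat (length vs) (length vs)
     (\<lambda>(i, j). if i = j then real (out_degree G (vs ! i)) else 0)"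

definition adjacency_mat :: "'a list \<Rightarrow> ('a, 'b) pre_digraph \<Rightarrow> real mat" where
  "adjacency_mat vs G = mat (length vs) (length vs)
     (\<lambda>(i, j). if vs ! i \<rightarrow>\<^bsub>G\<^esub> vs ! j then 1 else 0)"

definition laplacian_mat :: "'a list \<Rightarrow> ('a, 'b) pre_digraph \<Rightarrow> real mat" where
  "laplacian_mat vs G = degree_mat vs G - adjacency_mat vs G"

text \<open>
  The \<open>i\<close>-th smallest eigenvalue, counted with multiplicity and with \<open>i\<close> starting at 1. It is
  meaningful for \<open>1 \<le> i \<le> dim_row M\<close> when the characteristic polynomial of \<open>M\<close> splits over the
  reals, as it does for a symmetric \<open>M\<close> such as the Laplacian matrix of a graph.
\<close>

definition ith_eigenvalue :: "real mat \<Rightarrow> nat \<Rightarrow> real" where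
  "ith_eigenvalue M i = sorted_list_of_multiset (proots (char_poly M)) ! (i - 1)"

definition num_components :: "('a, 'b) pre_digraph \<Rightarrow> nat" where
  "num_components G = card (pre_digraph.sccs G)"

definition toughness :: "('a, 'b) pre_digraph \<Rightarrow> ereal" where
  "toughness G =
    (if complete_digraph (card (verts G)) G then \<infinity>
     else ereal (Min {real (card S) / real (num_components (G \<restriction> (verts G - S))) | S.
       S \<subset> verts G \<and> num_components (G \<restriction> (verts G - S)) > 1}))"

end

theory Submission
  imports Defs "Jordan_Normal_Form.Schur_Decomposition"
begin

text \<open>
  Let \<open>S\<close> be a vertex set whose removal leaves \<open>c \<ge> 2\<close> components. One vertex from each component
  gives an independent set of size \<open>c\<close>, so Hoffman's ratio bound yields
  \<open>c \<le> n (\<mu>\<^sub>n - \<delta>) / \<mu>\<^sub>n\<close>, and Fiedler's bound says \<open>\<mu>\<^sub>2 \<le> |S|\<close>; together these give the first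
  inequality. For the second, disjoint sets \<open>X\<close>, \<open>Y\<close> covering the complement of \<open>S\<close>, of size at
  least \<open>k\<close> each and without edges between them, satisfy \<open>2 \<mu>\<^sub>2 k \<le> (\<mu>\<^sub>n - \<mu>\<^sub>2) |S|\<close>. If some component has
  two vertices, the components can be distributed so that \<open>k = c / 2\<close> is allowed. Otherwise
  the complement of \<open>S\<close> is itself independent, its vertices have degree at least \<open>\<mu>\<^sub>2\<close> by Fiedler's bound,
  and Hoffman's bound applies again.
\<close>

subsection \<open>The spectral theorem for real symmetric matrices\<close>

lemma transpose_mult_self_eq_one_iff:
  fixes W :: "real mat"
  assumes W: "W \<in> carrier_mat n n"
  shows "W\<^sup>T * W = 1\<^sub>m n \<longleftrightarrow>
    (\<forall>i<n. \<forall>j<n. col W i \<bullet> col W j = (if i = j then 1 else 0))"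
proof
  assume eq: "W\<^sup>T * W = 1\<^sub>m n"
  show "\<forall>i<n. \<forall>j<n. col W i \<bullet> col W j = (if i = j then 1 else 0)"
  proof (intro allI impI)
    fix i j assume ij: "i < n" "j < n"
    have "(W\<^sup>T * W) $$ (i, j) = col W i \<bullet> col W j" using W ij by simp
    then show "col W i \<bullet> col W j = (if i = j then 1 else 0)" using ij eq by simp
  qed
next
  assume "\<forall>i<n. \<forall>j<n. col W i \<bullet> col W j = (if i = j then 1 else 0)"
  then show "W\<^sup>T * W = 1\<^sub>m n" using W by (intro eq_matI) auto
qed

text \<open>Complete \<open>v\<close> to a basis, apply Gram-Schmidt, which leaves the first vector
  as it is, and normalise; normalising turns the first column into a multiple of
  \<open>v\<close>.\<close>

lemma orthogonal_mat_extends_vec: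
  fixes v :: "real vec"
  assumes v: "v \<in> carrier_vec n" and v0: "v \<noteq> 0\<^sub>v n"
  obtains W c where "W \<in> carrier_mat n n" "W\<^sup>T * W = 1\<^sub>m n" "col W 0 = c \<cdot>\<^sub>v v"
proof -
  interpret cof_vec_space n "TYPE(real)" .
  have n: "n \<noteq> 0" using v v0 by (cases "n = 0") auto
  define b where "b = basis_completion v"
  define ws where "ws = gram_schmidt n b"
  from basis_completion[OF v v0, folded b_def]
  have dist_b: "distinct b" and indep: "\<not> lin_dep (set b)" and b: "set b \<subseteq> carrier_vec n"
    and hdb: "hd b = v" and len_b: "length b = n" by auto
  from hdb len_b n obtain bs where bv: "b = v # bs" by (cases b, auto)
  from gram_schmidt_result[OF b dist_b indep refl, folded ws_def]
  have ws: "set ws \<subseteq> carrier_vec n" "corthogonal ws" "length ws = n"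
    by (auto simp: len_b)
  from gram_schmidt_hd[OF v, of bs, folded bv] have hdws: "hd ws = v" unfolding ws_def .
  define nrm where "nrm w = 1 / sqrt (w \<bullet> w)" for w :: "real vec"
  define us where "us = map (\<lambda>w. nrm w \<cdot>\<^sub>v w) ws"
  define W where "W = mat_of_cols n us"
  have W: "W \<in> carrier_mat n n" using ws unfolding W_def us_def by auto
  have wsc: "ws ! i \<in> carrier_vec n" if "i < n" for i using ws that by auto
  have colW: "col W i = nrm (ws ! i) \<cdot>\<^sub>v (ws ! i)" if "i < n" for i
    using that ws wsc unfolding W_def us_def by (subst col_mat_of_cols) auto
  have conj: "conjugate w = w" for w :: "real vec" by (auto simp: conjugate_vec_def)
  have "col W i \<bullet> col W j = (if i = j then 1 else 0)" if "i < n" "j < n" for i j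
  proof -
    have "col W i \<bullet> col W j = nrm (ws ! i) * nrm (ws ! j) * (ws ! i \<bullet> ws ! j)"
      using that wsc[of i] wsc[of j]
      by (simp add: colW smult_scalar_prod_distrib[of _ n] scalar_prod_smult_distrib[of _ n])
    \<comment> \<open>For \<open>i = j\<close> this equivalence says that no \<open>ws ! i\<close>
      is zero, so that normalising it really gives a unit vector.\<close>
    moreover have "(ws ! i \<bullet> ws ! j = 0) = (i \<noteq> j)"
      using corthogonalD[OF ws(2), of i j] ws(3) that by (simp add: conj)
    moreover have "ws ! i \<bullet> ws ! i \<ge> 0" by (auto simp: scalar_prod_def intro: sum_nonneg)
    ultimately show ?thesis using that
      by (auto simp: nrm_def simp flip: real_sqrt_mult)
  qed
  then have "W\<^sup>T * W = 1\<^sub>m n" using transpose_mult_self_eq_one_iff[OF W] by blast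
  moreover have "col W 0 = nrm v \<cdot>\<^sub>v v"
    using colW[of 0] n hdws ws(3) by (cases ws) auto
  ultimately show ?thesis using that W by blast
qed

lemma mult_block_diag_mat:
  fixes A C :: "'a :: comm_ring_1 mat"
  assumes "A \<in> carrier_mat m m" "C \<in> carrier_mat m m" "B \<in> carrier_mat k k" "D \<in> carrier_mat k k"
  shows "four_block_mat A (0\<^sub>m m k) (0\<^sub>m k m) B * four_block_mat C (0\<^sub>m m k) (0\<^sub>m k m) D =
    four_block_mat (A * C) (0\<^sub>m m k) (0\<^sub>m k m) (B * D)"
  by (subst mult_four_block_mat[of _ m m _ k _ k _ _ m _ k]) (use assms in auto)

text \<open>Deflation, by induction on the list of eigenvalues. An eigenvector for the head
  \<open>e\<close>, normalised, becomes the first column of an orthogonal \<open>W\<close>. In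
  \<open>B\<close>, the conjugate of \<open>A\<close> by \<open>W\<close>, the first column is then
  zero below the corner \<open>e\<close>, symmetry clears the first row as well, and the induction
  hypothesis diagonalises the remaining block \<open>A3\<close>. The diagonal comes out in the order
  of \<open>es\<close>.\<close>

theorem real_spectral_theorem:
  fixes A :: "real mat"
  assumes "A \<in> carrier_mat n n" and "A\<^sup>T = A"
    and "char_poly A = (\<Prod>e\<leftarrow>es. [:- e, 1:])"
  shows "\<exists>U \<in> carrier_mat n n. U\<^sup>T * U = 1\<^sub>m n \<and> U\<^sup>T * A * U = mat_diag n (\<lambda>i. es ! i)"
  using assms
proof (induct es arbitrary: n A)
  case Nil
  with degree_monic_char_poly[of A n] have "n = 0" by auto
  then show ?case using Nil(1) by (intro bexI[of _ "1\<^sub>m n"]) (auto simp: mat_diag_def)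
next
  case (Cons e es n A)
  note A = Cons(2) and sym = Cons(3) and cp = Cons(4)
  have mon: "monic (\<Prod>e\<leftarrow> es. [:- e, 1:])" by (rule monic_prod_list, auto)
  have "degree (char_poly A) = Suc (degree (\<Prod>e\<leftarrow> es. [:- e, 1:]))" unfolding cp list.map prod_list.Cons
    by (subst degree_mult_eq, insert mon, auto)
  with degree_monic_char_poly[OF A] obtain k where n: "n = Suc k" by metis
  have "eigenvalue A e" unfolding eigenvalue_root_char_poly[OF A] cp by simp
  then obtain v where v: "v \<in> carrier_vec n" "v \<noteq> 0\<^sub>v n" "A *\<^sub>v v = e \<cdot>\<^sub>v v"
    using A unfolding eigenvalue_def eigenvector_def by auto
  obtain W c where W: "W \<in> carrier_mat n n" and WW: "W\<^sup>T * W = 1\<^sub>m n" and W0: "col W 0 = c \<cdot>\<^sub>v v"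
    using orthogonal_mat_extends_vec[OF v(1,2)] by blast
  define B where "B = W\<^sup>T * A * W"
  have WT: "W\<^sup>T \<in> carrier_mat n n" using W by simp
  have B: "B \<in> carrier_mat n n" unfolding B_def using W A by auto
  have "B\<^sup>T = W\<^sup>T * (A\<^sup>T * W)" unfolding B_def
    using W A by (simp add: transpose_mult[of _ n n _ n] transpose_mult[OF WT A])
  then have Bsym: "B\<^sup>T = B" unfolding sym B_def using W A by (simp add: assoc_mult_mat[of _ n n _ n _ n])
  have W'W: "W * W\<^sup>T = 1\<^sub>m n" by (rule mat_mult_left_right_inverse[OF WT W WW])
  have "similar_mat_wit B A W\<^sup>T W"
    by (rule similar_mat_witI[of _ _ n]) (use W A B WW W'W in \<open>auto simp: B_def\<close>)
  then have cpB: "char_poly B = (\<Prod>e\<leftarrow>e # es. [:- e, 1:])"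
    using char_poly_similar[of B A] cp unfolding similar_mat_def by metis
  have Bi0: "B $$ (i, 0) = (if i = 0 then e else 0)" if i: "i < n" for i
  proof -
    have AW: "A * W \<in> carrier_mat n n" using A W by simp
    have "B $$ (i, 0) = row W\<^sup>T i \<bullet> col (A * W) 0"
      unfolding B_def assoc_mult_mat[OF WT A W] using i n W A WT by (subst index_mult_mat) auto
    also have "col (A * W) 0 = A *\<^sub>v (c \<cdot>\<^sub>v v)"
      unfolding W0[symmetric] using n by (intro col_mult2[OF A W]) simp
    also have "\<dots> = e \<cdot>\<^sub>v col W 0" using v A by (simp add: mult_mat_vec[of _ n n] W0 smult_smult_assoc mult.commute)
    also have "row W\<^sup>T i \<bullet> (e \<cdot>\<^sub>v col W 0) = e * (col W i \<bullet> col W 0)" using i W n by simp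
    also have "\<dots> = (if i = 0 then e else 0)"
      using transpose_mult_self_eq_one_iff[OF W] WW i n by auto
    finally show ?thesis .
  qed
  obtain A1 A2 A0 A3 where split: "split_block B 1 1 = (A1,A2,A0,A3)"
    by (cases "split_block B 1 1", auto)
  have dimB: "dim_row B = 1 + k" "dim_col B = 1 + k" using B n by auto
  note sb = split_block[OF split dimB]
  have A1: "A1 = mat 1 1 (\<lambda>_. e)"
    using split[unfolded split_block_def Let_def] Bi0[of 0] n by auto
  have A0: "A0 = 0\<^sub>m k 1"
    using split[unfolded split_block_def Let_def] Bi0 B n by auto
  have B0i: "B $$ (0, i) = B $$ (i, 0)" if "i < n" for i
    using arg_cong[OF Bsym, of "\<lambda>M. M $$ (i, 0)"] that B n by simp
  have A2: "A2 = 0\<^sub>m 1 k"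
    using split[unfolded split_block_def Let_def] Bi0 B0i B n by auto
  have A3: "A3 \<in> carrier_mat k k" by (rule sb)
  have A3sym: "A3\<^sup>T = A3"
  proof (rule eq_matI)
    fix i j assume "i < dim_row A3" "j < dim_col A3"
    then have ij: "i < k" "j < k" using A3 by auto
    have "A3 $$ (a, b) = B $$ (Suc a, Suc b)" if "a < k" "b < k" for a b
      using split[unfolded split_block_def Let_def] that dimB by auto
    moreover have "B $$ (Suc j, Suc i) = B $$ (Suc i, Suc j)"
      using arg_cong[OF Bsym, of "\<lambda>M. M $$ (Suc i, Suc j)"] ij dimB by simp
    ultimately show "A3\<^sup>T $$ (i, j) = A3 $$ (i, j)" using ij A3 by simp
  qed (use A3 in auto)
  \<comment> \<open>Cancelling the factor of the corner leaves exactly the roots \<open>es\<close>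
    for \<open>A3\<close>, as the induction hypothesis demands.\<close>
  have "char_poly B = char_poly A1 * char_poly A3"
    unfolding sb(5) unfolding A0 by (rule char_poly_four_block_zeros_col) (use sb in auto)
  also have "char_poly A1 = [: -e,1 :]"
    by (simp add: A1 char_poly_defs det_def sign_def)
  finally have cp3: "char_poly A3 = (\<Prod> e \<leftarrow> es. [:- e, 1:])"
    unfolding cpB by (simp del: mult_pCons_left)
  from Cons(1)[OF A3 A3sym cp3] obtain U where U: "U \<in> carrier_mat k k" "U\<^sup>T * U = 1\<^sub>m k"
      "U\<^sup>T * A3 * U = mat_diag k (\<lambda>i. es ! i)" by auto
  \<comment> \<open>Bordering \<open>U\<close> by a 1 keeps it orthogonal and does not touch the
    corner \<open>e\<close>; \<open>W * F\<close> is the matrix sought.\<close>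
  define F where "F = four_block_mat (1\<^sub>m 1) (0\<^sub>m 1 k) (0\<^sub>m k 1) U"
  have F: "F \<in> carrier_mat n n" unfolding F_def n using four_block_carrier_mat[OF _ U(1), of "1\<^sub>m 1" 1 1] by simp
  have FT: "F\<^sup>T = four_block_mat (1\<^sub>m 1) (0\<^sub>m 1 k) (0\<^sub>m k 1) U\<^sup>T"
    unfolding F_def using U by (subst transpose_four_block_mat) auto
  have FTc: "F\<^sup>T \<in> carrier_mat n n" using F by simp
  have UT: "U\<^sup>T \<in> carrier_mat k k" using U by simp
  have A1c: "A1 \<in> carrier_mat 1 1" by (rule sb)
  have FF: "F\<^sup>T * F = 1\<^sub>m n"
    unfolding FT unfolding F_def
    by (subst mult_block_diag_mat[OF _ _ UT U(1), of _ 1]) (use U n in auto)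
  have "F\<^sup>T * B * F = four_block_mat A1 (0\<^sub>m 1 k) (0\<^sub>m k 1) (U\<^sup>T * A3 * U)"
    unfolding FT sb(5) A0 A2 unfolding F_def
    using A1c A3 U UT
    by (simp add: mult_block_diag_mat[of _ 1 _ _ k] mult_block_diag_mat[of _ "Suc 0" _ _ k])
  also have "\<dots> = mat_diag n (\<lambda>i. (e # es) ! i)"
    unfolding U(3) A1 n by (rule eq_matI) (auto simp: mat_diag_def)
  finally have FBF: "F\<^sup>T * B * F = mat_diag n (\<lambda>i. (e # es) ! i)" .
  have WF: "(W * F)\<^sup>T = F\<^sup>T * W\<^sup>T" by (rule transpose_mult[OF W F])
  have "(W * F)\<^sup>T * (W * F) = F\<^sup>T * (W\<^sup>T * W) * F" unfolding WF using W F WT FTc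
    by (simp add: assoc_mult_mat[of _ n n _ n _ n])
  also have "\<dots> = 1\<^sub>m n" unfolding WW using FTc FF by simp
  finally have 1: "(W * F)\<^sup>T * (W * F) = 1\<^sub>m n" .
  have "(W * F)\<^sup>T * A * (W * F) = F\<^sup>T * B * F" unfolding WF B_def using W F WT FTc A
    by (simp add: assoc_mult_mat[of _ n n _ n _ n])
  with 1 FBF W F show ?case by (intro bexI[of _ "W * F"]) auto
qed

text \<open>The characteristic polynomial splits over the complex numbers. Moving \<open>C\<close>
  across the Hermitian product of an eigenvector with itself gives \<open>a = cnj a\<close> for
  every root \<open>a\<close>, and the embedding of real into complex polynomials is injective, so
  the factorisation descends.\<close>

lemma real_symmetric_char_poly_splits:
  fixes A :: "real mat"
  assumes A: "A \<in> carrier_mat n n" and sym: "A\<^sup>T = A"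
  shows "\<exists>es. char_poly A = (\<Prod>e\<leftarrow>es. [:- e, 1:])"
proof -
  define C where "C = map_mat complex_of_real A"
  have C: "C \<in> carrier_mat n n" using A by (simp add: C_def)
  have Csym: "C\<^sup>T = C" unfolding C_def by (metis sym map_mat_transpose)
  obtain as where as: "char_poly C = (\<Prod>a\<leftarrow>as. [:- a, 1:])"
    using char_poly_factorized[OF C] by blast
  \<comment> \<open>\<open>C\<close> has real entries, hence commutes with conjugation.\<close>
  have Creal: "C *\<^sub>v conjugate v = conjugate (C *\<^sub>v v)" if "v \<in> carrier_vec n" for v
    using that A by (intro eq_vecI) (auto simp: C_def scalar_prod_def)
  have real: "complex_of_real (Re a) = a" if "a \<in> set as" for a
  proof -
    have "poly (char_poly C) a = 0" using that unfolding as by (induct as) auto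
    then have "eigenvalue C a" using eigenvalue_root_char_poly[OF C] by simp
    then obtain v where v: "v \<in> carrier_vec n" "v \<noteq> 0\<^sub>v n" and Cv: "C *\<^sub>v v = a \<cdot>\<^sub>v v"
      using C unfolding eigenvalue_def eigenvector_def by auto
    have cv: "conjugate v \<in> carrier_vec n" using v by simp
    have "a * (v \<bullet>c v) = (C\<^sup>T *\<^sub>v v) \<bullet>c v" using v cv by (simp add: Csym Cv)
    also have "\<dots> = v \<bullet> (C *\<^sub>v conjugate v)" by (rule transpose_vec_mult_scalar[OF C cv v(1)])
    also have "\<dots> = v \<bullet> (cnj a \<cdot>\<^sub>v conjugate v)"
      using v by (simp add: Creal Cv conjugate_smult_vec)
    also have "\<dots> = cnj a * (v \<bullet>c v)" using v cv by simp
    finally have "a = cnj a" using conjugate_square_eq_0_vec[OF v(1)] v(2) by simp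
    then show ?thesis by (metis complex_cnj_cancel_iff complex_eq_iff cnj.simps(2) Re_complex_of_real Im_complex_of_real neg_equal_zero)
  qed
  have as_real: "as = map (complex_of_real \<circ> Re) as"
    using real by (simp add: map_idI)
  interpret h: map_poly_inj_idom_hom complex_of_real ..
  have "map_poly complex_of_real (char_poly A) = char_poly C"
    unfolding C_def by (rule of_real_hom.char_poly_hom[OF A, symmetric])
  also have "\<dots> = (\<Prod>e\<leftarrow>map Re as. map_poly complex_of_real [:- e, 1:])"
    unfolding as by (subst as_real) (simp add: o_def)
  also have "\<dots> = map_poly complex_of_real (\<Prod>e\<leftarrow>map Re as. [:- e, 1:])"
    by (simp add: h.hom_prod_list o_def)
  finally show ?thesis by (intro exI[of _ "map Re as"]) (rule h.injectivity)
qed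

lemma mat_diag_mult_vec:
  fixes y :: "'a :: semiring_0 vec"
  assumes "y \<in> carrier_vec n"
  shows "mat_diag n f *\<^sub>v y = vec n (\<lambda>i. f i * y $ i)"
proof (rule eq_vecI)
  fix i assume "i < dim_vec (vec n (\<lambda>i. f i * y $ i))"
  then have i: "i < n" by simp
  then have "(mat_diag n f *\<^sub>v y) $ i = (\<Sum>j = 0..<n. (if i = j then f j else 0) * y $ j)"
    using assms by (simp add: mat_diag_def scalar_prod_def)
  also have "\<dots> = f i * y $ i"
    using i by (subst sum.remove[of _ i]) auto
  finally show "(mat_diag n f *\<^sub>v y) $ i = vec n (\<lambda>i. f i * y $ i) $ i"
    using i by simp
qed (simp add: mat_diag_def)

text \<open>\<open>T x i\<close> is the \<open>i\<close>-th coordinate of \<open>x\<close> in an orthonormal basis of eigenvectors.\<close>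

lemma real_symmetric_eigencoordinates:
  fixes A :: "real mat"
  assumes A: "A \<in> carrier_mat n n" and sym: "A\<^sup>T = A"
  obtains T :: "real vec \<Rightarrow> nat \<Rightarrow> real" where
    "\<And>x z. x \<in> carrier_vec n \<Longrightarrow> z \<in> carrier_vec n \<Longrightarrow> x \<bullet> z = (\<Sum>i<n. T x i * T z i)"
    "\<And>x i. x \<in> carrier_vec n \<Longrightarrow> i < n \<Longrightarrow>
      T (A *\<^sub>v x) i = ith_eigenvalue A (Suc i) * T x i"
    "\<And>i. i < n \<Longrightarrow> \<exists>x \<in> carrier_vec n. \<forall>j<n. T x j = (if j = i then 1 else 0)"
    "\<And>i j. i \<le> j \<Longrightarrow> j < n \<Longrightarrow> ith_eigenvalue A (Suc i) \<le> ith_eigenvalue A (Suc j)"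
proof -
  obtain es' where es': "char_poly A = (\<Prod>e\<leftarrow>es'. [:- e, 1:])"
    using real_symmetric_char_poly_splits[OF A sym] by blast
  have "proots (char_poly A) = mset es'"
    unfolding es'
  proof (induct es')
    case (Cons e es)
    have "(\<Prod>e\<leftarrow>es. [:- e, 1:]) \<noteq> 0" by (auto simp: prod_list_zero_iff)
    then have "proots ([:- e, 1:] * (\<Prod>e\<leftarrow>es. [:- e, 1:])) = {#e#} + mset es"
      using Cons by (subst proots_mult) auto
    then show ?case by simp
  qed simp
  then have ith: "ith_eigenvalue A (Suc i) = sort es' ! i" for i
    by (simp add: ith_eigenvalue_def)
  \<comment> \<open>The spectral theorem takes the roots in any order; the sorted one makes
    coordinate \<open>i\<close>, counted from 0, belong to the eigenvalue of rank
    \<open>Suc i\<close>.\<close>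
  have "(\<Prod>e\<leftarrow>es'. [:- e, 1:]) = (\<Prod>e\<leftarrow>sort es'. [:- e, 1:])"
    by (simp only: mset_map mset_sort flip: prod_mset_prod_list)
  then have es: "char_poly A = (\<Prod>e\<leftarrow>sort es'. [:- e, 1:])" using es' by simp
  have "degree (char_poly A) = length (sort es')"
    unfolding es by (rule degree_linear_factors)
  then have len: "length (sort es') = n" using degree_monic_char_poly[OF A] by metis
  obtain U where U: "U \<in> carrier_mat n n" "U\<^sup>T * U = 1\<^sub>m n"
      "U\<^sup>T * A * U = mat_diag n (\<lambda>i. sort es' ! i)"
    using real_spectral_theorem[OF A sym es] by blast
  have UT: "U\<^sup>T \<in> carrier_mat n n" using U by simp
  have UU: "U * U\<^sup>T = 1\<^sub>m n" by (rule mat_mult_left_right_inverse[OF UT U(1,2)])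
  define T where "T x i = (U\<^sup>T *\<^sub>v x) $ i" for x i
  show thesis
  proof (rule that[of T])
    fix x z :: "real vec" assume x: "x \<in> carrier_vec n" and z: "z \<in> carrier_vec n"
    have "(U\<^sup>T *\<^sub>v x) \<bullet> (U\<^sup>T *\<^sub>v z) = x \<bullet> (U *\<^sub>v (U\<^sup>T *\<^sub>v z))"
      by (rule transpose_vec_mult_scalar[OF U(1) _ x]) (use UT z in auto)
    also have "U *\<^sub>v (U\<^sup>T *\<^sub>v z) = z"
      using U(1) UT z by (simp add: UU flip: assoc_mult_mat_vec[of _ n n _ n])
    finally show "x \<bullet> z = (\<Sum>i<n. T x i * T z i)"
      using UT unfolding T_def by (simp add: scalar_prod_def lessThan_atLeast0)
  next
    fix x :: "real vec" and i assume x: "x \<in> carrier_vec n" and i: "i < n"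
    have Ux: "U\<^sup>T *\<^sub>v x \<in> carrier_vec n" using UT x by auto
    have "U\<^sup>T *\<^sub>v (A *\<^sub>v x) = U\<^sup>T *\<^sub>v (A *\<^sub>v (U * U\<^sup>T *\<^sub>v x))"
      using x by (simp add: UU)
    also have "\<dots> = U\<^sup>T * A * U *\<^sub>v (U\<^sup>T *\<^sub>v x)"
      using x A U(1) UT Ux by (simp add: assoc_mult_mat_vec[of _ n n _ n])
    finally show "T (A *\<^sub>v x) i = ith_eigenvalue A (Suc i) * T x i"
      unfolding T_def ith U(3) mat_diag_mult_vec[OF Ux] using i by simp
  next
    fix i assume i: "i < n"
    have "T (col U i) j = (if j = i then 1 else 0)" if "j < n" for j
      using transpose_mult_self_eq_one_iff[OF U(1)] U(1,2) i that unfolding T_def by simp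
    then show "\<exists>x \<in> carrier_vec n. \<forall>j<n. T x j = (if j = i then 1 else 0)"
      using U(1) by (intro bexI[of _ "col U i"]) auto
  next
    fix i j assume "i \<le> j" "j < n"
    then show "ith_eigenvalue A (Suc i) \<le> ith_eigenvalue A (Suc j)"
      unfolding ith using len by (intro sorted_nth_mono) auto
  qed
qed

section \<open>Rayleigh bounds for symmetric matrices\<close>

lemma rayleigh_upper_bound:
  fixes A :: "real mat"
  assumes A: "A \<in> carrier_mat n n" and sym: "A\<^sup>T = A" and x: "x \<in> carrier_vec n"
  shows "x \<bullet> (A *\<^sub>v x) \<le> ith_eigenvalue A n * (x \<bullet> x)"
proof -
  obtain T where T:
    "\<And>x z. x \<in> carrier_vec n \<Longrightarrow> z \<in> carrier_vec n \<Longrightarrow> x \<bullet> z = (\<Sum>i<n. T x i * T z i)"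
    "\<And>x i. x \<in> carrier_vec n \<Longrightarrow> i < n \<Longrightarrow> T (A *\<^sub>v x) i = ith_eigenvalue A (Suc i) * T x i"
    and basis: "\<And>i. i < n \<Longrightarrow> \<exists>x \<in> carrier_vec n. \<forall>j<n. T x j = (if j = i then 1 else 0)"
    and mono: "\<And>i j. i \<le> j \<Longrightarrow> j < n \<Longrightarrow> ith_eigenvalue A (Suc i) \<le> ith_eigenvalue A (Suc j)"
    by (rule real_symmetric_eigencoordinates[OF A sym]) blast
  have "A *\<^sub>v x \<in> carrier_vec n" using A x by simp
  then have "x \<bullet> (A *\<^sub>v x) = (\<Sum>i<n. ith_eigenvalue A (Suc i) * (T x i * T x i))"
    using T x by (auto intro!: sum.cong)
  also have "\<dots> \<le> (\<Sum>i<n. ith_eigenvalue A n * (T x i * T x i))"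
    using mono[of _ "n - 1"] by (intro sum_mono mult_right_mono) auto
  also have "\<dots> = ith_eigenvalue A n * (x \<bullet> x)"
    using T x by (simp add: sum_distrib_left)
  finally show ?thesis .
qed

text \<open>At the basis eigenvector number \<open>i\<close> the quadratic form takes the eigenvalue
  itself as its value.\<close>

lemma psd_ith_eigenvalue_nonneg:
  fixes A :: "real mat"
  assumes A: "A \<in> carrier_mat n n" and sym: "A\<^sup>T = A"
    and psd: "\<And>x. x \<in> carrier_vec n \<Longrightarrow> 0 \<le> x \<bullet> (A *\<^sub>v x)" and i: "i < n"
  shows "0 \<le> ith_eigenvalue A (Suc i)"
proof -
  obtain T where T:
    "\<And>x z. x \<in> carrier_vec n \<Longrightarrow> z \<in> carrier_vec n \<Longrightarrow> x \<bullet> z = (\<Sum>i<n. T x i * T z i)"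
    "\<And>x i. x \<in> carrier_vec n \<Longrightarrow> i < n \<Longrightarrow> T (A *\<^sub>v x) i = ith_eigenvalue A (Suc i) * T x i"
    and basis: "\<And>i. i < n \<Longrightarrow> \<exists>x \<in> carrier_vec n. \<forall>j<n. T x j = (if j = i then 1 else 0)"
    and mono: "\<And>i j. i \<le> j \<Longrightarrow> j < n \<Longrightarrow> ith_eigenvalue A (Suc i) \<le> ith_eigenvalue A (Suc j)"
    by (rule real_symmetric_eigencoordinates[OF A sym]) blast
  obtain x where x: "x \<in> carrier_vec n" "\<And>j. j < n \<Longrightarrow> T x j = (if j = i then 1 else 0)"
    using basis[OF i] by blast
  have "A *\<^sub>v x \<in> carrier_vec n" using A x by simp
  then have "x \<bullet> (A *\<^sub>v x) = (\<Sum>j<n. T x j * T (A *\<^sub>v x) j)" by (rule T(1)[OF x(1)])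
  also have "\<dots> = (\<Sum>j<n. if j = i then ith_eigenvalue A (Suc i) else 0)"
    by (intro sum.cong refl) (simp add: x T(2)[OF x(1)])
  also have "\<dots> = ith_eigenvalue A (Suc i)" using i by simp
  finally show ?thesis using psd[OF x(1)] by simp
qed

text \<open>If the second eigenvalue is positive, then the kernel is a line, namely the first eigenspace.\<close>

lemma rayleigh_lower_bound:
  fixes A :: "real mat"
  assumes A: "A \<in> carrier_mat n n" and sym: "A\<^sup>T = A" and n: "2 \<le> n"
    and psd: "\<And>x. x \<in> carrier_vec n \<Longrightarrow> 0 \<le> x \<bullet> (A *\<^sub>v x)"
    and w: "w \<in> carrier_vec n" "w \<noteq> 0\<^sub>v n" "A *\<^sub>v w = 0\<^sub>v n"
    and x: "x \<in> carrier_vec n" and orth: "x \<bullet> w = 0"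
  shows "ith_eigenvalue A 2 * (x \<bullet> x) \<le> x \<bullet> (A *\<^sub>v x)"
proof (cases "ith_eigenvalue A 2 = 0")
  \<comment> \<open>Here the kernel may be larger than the line of \<open>w\<close>, but the claim
    reduces to semidefiniteness.\<close>
  case True
  then show ?thesis using psd[OF x] by simp
next
  case False
  let ?e = "\<lambda>i. ith_eigenvalue A (Suc i)"
  obtain T where T:
    "\<And>x z. x \<in> carrier_vec n \<Longrightarrow> z \<in> carrier_vec n \<Longrightarrow> x \<bullet> z = (\<Sum>i<n. T x i * T z i)"
    "\<And>x i. x \<in> carrier_vec n \<Longrightarrow> i < n \<Longrightarrow> T (A *\<^sub>v x) i = ith_eigenvalue A (Suc i) * T x i"
    and basis: "\<And>i. i < n \<Longrightarrow> \<exists>x \<in> carrier_vec n. \<forall>j<n. T x j = (if j = i then 1 else 0)"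
    and mono: "\<And>i j. i \<le> j \<Longrightarrow> j < n \<Longrightarrow> ith_eigenvalue A (Suc i) \<le> ith_eigenvalue A (Suc j)"
    by (rule real_symmetric_eigencoordinates[OF A sym]) blast
  have "0 \<le> ?e 1" using n by (intro psd_ith_eigenvalue_nonneg[OF A sym psd]) auto
  then have pos: "0 < ?e 1" using False by (simp add: numeral_2_eq_2)
  \<comment> \<open>Linearity of \<open>T\<close> is not among the known facts; \<open>T\<close>
    vanishes at zero because it preserves scalar products.\<close>
  have z0: "T (0\<^sub>v n) i = 0" if "i < n" for i
  proof -
    have "(\<Sum>i<n. T (0\<^sub>v n) i * T (0\<^sub>v n) i) = 0" using T(1)[of "0\<^sub>v n" "0\<^sub>v n"] by simp
    then have "\<forall>i\<in>{..<n}. T (0\<^sub>v n) i * T (0\<^sub>v n) i = 0" by (subst (asm) sum_nonneg_eq_0_iff) auto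
    then show ?thesis using that by simp
  qed
  \<comment> \<open>Coordinates beyond the first belong to positive eigenvalues, so a kernel vector
    has none of them. Orthogonality to \<open>w\<close> then forces \<open>T x 0 = 0\<close>, and
    the smallest eigenvalue drops out of the sum.\<close>
  have Tw: "T w i = 0" if "1 \<le> i" "i < n" for i
  proof -
    have "?e i * T w i = 0" using T(2)[OF w(1) that(2)] w(3) z0[OF that(2)] by simp
    then show ?thesis using mono[OF that] pos by auto
  qed
  have split: "(\<Sum>i<n. f i) = f 0 + (\<Sum>i\<in>{1..<n}. f i)" for f :: "nat \<Rightarrow> real"
    using n by (simp add: lessThan_atLeast0 sum.atLeast_Suc_lessThan)
  have "w \<bullet> w = T w 0 * T w 0" using T(1)[OF w(1) w(1)] Tw by (simp add: split)
  moreover have "w \<bullet> w \<noteq> 0"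
    using conjugate_square_eq_0_vec[OF w(1)] w(2) by (simp add: conjugate_vec_def)
  moreover have "x \<bullet> w = T x 0 * T w 0" using T(1)[OF x w(1)] Tw by (simp add: split)
  ultimately have Tx0: "T x 0 = 0" using orth by auto
  have "ith_eigenvalue A 2 * (x \<bullet> x) = (\<Sum>i<n. ?e 1 * (T x i * T x i))"
    using T(1)[OF x x] by (simp add: sum_distrib_left numeral_2_eq_2)
  also have "\<dots> \<le> (\<Sum>i<n. ?e i * (T x i * T x i))"
    unfolding split using Tx0 mono by (simp, intro sum_mono mult_right_mono) auto
  also have "\<dots> = (\<Sum>i<n. T x i * T (A *\<^sub>v x) i)"
    using T(2) x by (intro sum.cong) auto
  also have "\<dots> = x \<bullet> (A *\<^sub>v x)"
    using A x T(1)[of x "A *\<^sub>v x"] by simp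
  finally show ?thesis .
qed

subsection \<open>Eigenvalue bounds for vertex cuts and independent sets\<close>

text \<open>The quadratic form of the Laplacian. Every undirected edge occurs as two ordered pairs,
  hence the division by 2.\<close>

definition dirichlet_form :: "'a set \<Rightarrow> ('a \<Rightarrow> 'a \<Rightarrow> bool) \<Rightarrow> ('a \<Rightarrow> real) \<Rightarrow> real" where
  "dirichlet_form V E f = (\<Sum>v\<in>V. \<Sum>w\<in>V. of_bool (E v w) * (f v - f w)\<^sup>2) / 2"

definition rel_degree :: "'a set \<Rightarrow> ('a \<Rightarrow> 'a \<Rightarrow> bool) \<Rightarrow> 'a \<Rightarrow> nat" where
  "rel_degree V E v = card {w \<in> V. E v w}"

text \<open>\<open>l\<close> and \<open>m\<close> play the roles of \<open>\<mu>\<^sub>2\<close> and \<open>\<mu>\<^sub>n\<close>.\<close>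

locale spectral_bounds =
  fixes V :: "'a set" and E :: "'a \<Rightarrow> 'a \<Rightarrow> bool" and l m :: real
  assumes finite_V: "finite V"
    and E_sym: "E v w \<Longrightarrow> E w v"
    and E_irrefl: "\<not> E v v"
    and lower: "(\<Sum>v\<in>V. f v) = 0 \<Longrightarrow> l * (\<Sum>v\<in>V. (f v)\<^sup>2) \<le> dirichlet_form V E f"
    and upper: "dirichlet_form V E f \<le> m * (\<Sum>v\<in>V. (f v)\<^sup>2)"
    and l_nonneg: "0 \<le> l"
begin

text \<open>This is \<open>card V\<close> times the sum of squared deviations of \<open>f\<close>
  from its mean.\<close>

definition scaled_variance :: "('a \<Rightarrow> real) \<Rightarrow> real" where
  "scaled_variance f = real (card V) * (\<Sum>v\<in>V. (f v)\<^sup>2) - (\<Sum>v\<in>V. f v)\<^sup>2"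

lemma dirichlet_form_translate: "dirichlet_form V E (\<lambda>v. f v - c) = dirichlet_form V E f"
  by (simp add: dirichlet_form_def)

text \<open>Subtracting the mean leaves the Dirichlet form unchanged. It makes \<open>lower\<close>
  applicable to every \<open>f\<close>, and it sharpens \<open>upper\<close>.\<close>

lemma
  assumes "V \<noteq> {}"
  shows centered_lower: "l * scaled_variance f \<le> card V * dirichlet_form V E f"
    and centered_upper: "card V * dirichlet_form V E f \<le> m * scaled_variance f"
proof -
  let ?n = "real (card V)"
  have n: "?n > 0" using assms finite_V by (simp add: card_gt_0_iff)
  define c where "c = (\<Sum>v\<in>V. f v) / ?n"
  have sum0: "(\<Sum>v\<in>V. f v - c) = 0" using n by (simp add: sum_subtractf c_def)
  have "(f v - c)\<^sup>2 = (f v)\<^sup>2 - 2 * c * f v + c\<^sup>2" for v by (simp add: power2_diff)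
  then have "(\<Sum>v\<in>V. (f v - c)\<^sup>2) = (\<Sum>v\<in>V. (f v)\<^sup>2) - 2 * c * (\<Sum>v\<in>V. f v) + ?n * c\<^sup>2"
    by (simp add: sum.distrib sum_subtractf flip: sum_distrib_left)
  also have "?n * \<dots> = scaled_variance f"
    using n unfolding c_def scaled_variance_def by (simp add: field_simps power2_eq_square)
  finally have var: "?n * (\<Sum>v\<in>V. (f v - c)\<^sup>2) = scaled_variance f" .
  show "l * scaled_variance f \<le> ?n * dirichlet_form V E f"
    using mult_left_mono[OF lower[OF sum0], of ?n] n
    by (simp add: dirichlet_form_translate algebra_simps flip: var)
  show "?n * dirichlet_form V E f \<le> m * scaled_variance f"
    using mult_left_mono[OF upper[of "\<lambda>v. f v - c"], of ?n] n
    by (simp add: dirichlet_form_translate algebra_simps flip: var)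
qed

definition separated :: "'a set \<Rightarrow> 'a set \<Rightarrow> bool" where
  "separated X Y \<longleftrightarrow> X \<subseteq> V \<and> Y \<subseteq> V \<and> X \<inter> Y = {} \<and> (\<forall>x\<in>X. \<forall>y\<in>Y. \<not> E x y)"

lemma separated_sym: "separated X Y \<Longrightarrow> separated Y X"
  unfolding separated_def using E_sym by blast

lemma sum_piecewise:
  assumes "separated X Y" and "\<And>v. v \<in> V \<Longrightarrow> v \<notin> X \<Longrightarrow> v \<notin> Y \<Longrightarrow> g v = 0"
    and "\<And>v. v \<in> X \<Longrightarrow> g v = a" and "\<And>v. v \<in> Y \<Longrightarrow> g v = b"
  shows "(\<Sum>v\<in>V. g v) = a * real (card X) + b * real (card Y)"
proof -
  have XY: "X \<inter> Y = {}" "X \<union> Y \<subseteq> V" using assms(1) by (auto simp: separated_def)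
  have "(\<Sum>v\<in>V. g v) = (\<Sum>v\<in>X \<union> Y. g v)"
    using XY finite_V assms(2) by (intro sum.mono_neutral_right) auto
  also have "\<dots> = (\<Sum>v\<in>X. g v) + (\<Sum>v\<in>Y. g v)"
    using XY finite_V by (intro sum.union_disjoint) (auto intro: finite_subset)
  finally show ?thesis using assms(3,4) by simp
qed

lemma cut_size:
  assumes "separated X Y"
  shows "card (V - X - Y) + card X + card Y = card V"
proof -
  have XY: "X \<inter> Y = {}" "X \<union> Y \<subseteq> V" using assms by (auto simp: separated_def)
  have fin: "finite X" "finite Y" using XY finite_V by (auto intro: finite_subset)
  have "card (X \<union> Y) = card X + card Y" using XY fin by (simp add: card_Un_disjoint)
  moreover have "card (X \<union> Y) \<le> card V" using XY finite_V by (simp add: card_mono)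
  moreover have "V - X - Y = V - (X \<union> Y)" by blast
  ultimately show ?thesis using XY finite_V fin by (simp add: card_Diff_subset)
qed

text \<open>For a test function that is constant on \<open>X\<close> and on \<open>Y\<close> and
  zero on the cut \<open>S\<close>, only edges meeting \<open>S\<close> contribute, and each
  contributes at most the square of the value at its other end. Hence the form is at most
  \<open>card S\<close> times the sum of squares.\<close>

lemma fiedler_bound:
  assumes sep: "separated X Y" and "X \<noteq> {}" "Y \<noteq> {}"
  shows "l \<le> card (V - X - Y)"
proof -
  define S where "S = V - X - Y"
  define x y where "x = real (card X)" and "y = real (card Y)"
  have XY: "X \<inter> Y = {}" "X \<subseteq> V" "Y \<subseteq> V" "\<And>v w. v \<in> X \<Longrightarrow> w \<in> Y \<Longrightarrow> \<not> E v w"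
    using sep by (auto simp: separated_def)
  have pos: "x > 0" "y > 0"
    using assms XY finite_V unfolding x_def y_def by (auto simp: card_gt_0_iff intro: finite_subset)
  \<comment> \<open>The two values are weighted so that \<open>f\<close> sums to zero, as
    \<open>lower\<close> requires.\<close>
  define f where "f v = (if v \<in> X then y else if v \<in> Y then - x else 0)" for v
  have "(\<Sum>v\<in>V. f v) = y * real (card X) + (- x) * real (card Y)"
    by (rule sum_piecewise[OF sep]) (use XY in \<open>auto simp: f_def\<close>)
  then have sum0: "(\<Sum>v\<in>V. f v) = 0" by (simp add: x_def y_def)
  have "(\<Sum>v\<in>V. (f v)\<^sup>2) = y\<^sup>2 * real (card X) + x\<^sup>2 * real (card Y)"
    by (rule sum_piecewise[OF sep]) (use XY in \<open>auto simp: f_def\<close>)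
  then have sq: "(\<Sum>v\<in>V. (f v)\<^sup>2) > 0"
    using pos by (simp add: add_pos_pos flip: x_def y_def)
  have pt: "of_bool (E v w) * (f v - f w)\<^sup>2 \<le> of_bool (w \<in> S) * (f v)\<^sup>2 + of_bool (v \<in> S) * (f w)\<^sup>2"
    if "v \<in> V" "w \<in> V" for v w
  proof (cases "v \<in> S \<or> w \<in> S")
    case True
    then have "f v = 0 \<and> v \<in> S \<or> f w = 0 \<and> w \<in> S" by (auto simp: f_def S_def)
    then show ?thesis by auto
  next
    case False
    then have "\<not> E v w \<or> f v = f w" using that XY(4) E_sym by (auto simp: f_def S_def)
    then show ?thesis by auto
  qed
  have "2 * dirichlet_form V E f = (\<Sum>v\<in>V. \<Sum>w\<in>V. of_bool (E v w) * (f v - f w)\<^sup>2)"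
    by (simp add: dirichlet_form_def)
  also have "\<dots> \<le> (\<Sum>v\<in>V. \<Sum>w\<in>V. of_bool (w \<in> S) * (f v)\<^sup>2 + of_bool (v \<in> S) * (f w)\<^sup>2)"
    by (intro sum_mono pt)
  also have "\<dots> = 2 * ((\<Sum>w\<in>V. of_bool (w \<in> S)) * (\<Sum>v\<in>V. (f v)\<^sup>2))"
    unfolding sum.distrib by (subst sum.swap) (simp flip: sum_distrib_left sum_distrib_right)
  also have "(\<Sum>w\<in>V. of_bool (w \<in> S)) = real (card S)"
    using finite_V by (simp add: S_def Int_def of_bool_def sum.If_cases set_diff_eq)
  finally have "l * (\<Sum>v\<in>V. (f v)\<^sup>2) \<le> card S * (\<Sum>v\<in>V. (f v)\<^sup>2)"
    using lower[OF sum0] by simp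
  then show ?thesis using sq by (simp add: S_def)
qed

text \<open>The neighbours of \<open>v\<close> form a cut between \<open>v\<close> and its
  non-neighbours, of which \<open>w\<close> is one.\<close>

lemma nonneighbour_degree_bound:
  assumes "v \<in> V" "w \<in> V" "w \<noteq> v" "\<not> E v w"
  shows "l \<le> rel_degree V E v"
proof -
  let ?Y = "{w \<in> V. w \<noteq> v \<and> \<not> E v w}"
  have "l \<le> card (V - {v} - ?Y)"
    by (rule fiedler_bound) (use assms in \<open>auto simp: separated_def\<close>)
  also have "V - {v} - ?Y = {w \<in> V. E v w}" using E_irrefl by auto
  finally show ?thesis by (simp add: rel_degree_def)
qed

text \<open>Test \<open>centered_upper\<close> with the indicator of \<open>I\<close>: no edge lies
  inside \<open>I\<close>, so the Dirichlet form is the sum of the degrees over \<open>I\<close>.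
  The degree bound is asked for on \<open>I\<close> only, which permits \<open>d = l\<close> when
  just the vertices of \<open>I\<close> are known to have non-neighbours.\<close>

lemma hoffman_bound:
  fixes d :: real
  assumes I: "I \<subseteq> V" "I \<noteq> {}" and indep: "\<And>v w. v \<in> I \<Longrightarrow> w \<in> I \<Longrightarrow> \<not> E v w"
    and deg: "\<And>v. v \<in> I \<Longrightarrow> d \<le> rel_degree V E v"
  shows "d * card V \<le> m * (real (card V) - card I)"
proof -
  define f :: "'a \<Rightarrow> real" where "f v = of_bool (v \<in> I)" for v
  have finI: "finite I" using I finite_V by (auto intro: finite_subset)
  have VI: "V \<inter> I = I" using I by auto
  have sq: "(f v)\<^sup>2 = f v" for v by (simp add: f_def)
  have sums: "(\<Sum>v\<in>V. f v) = card I" "(\<Sum>v\<in>V. (f v)\<^sup>2) = card I"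
    unfolding sq using finite_V VI by (simp_all add: f_def Int_def of_bool_def sum.If_cases)
  \<comment> \<open>At most one end of an edge is in \<open>I\<close>, so the squared difference is
    the sum of the two indicator values.\<close>
  have pt: "of_bool (E v w) * (f v - f w)\<^sup>2 = of_bool (E v w) * f v + of_bool (E w v) * f w" for v w
    using indep E_sym by (auto simp: f_def)
  have deg_sum: "(\<Sum>w\<in>V. of_bool (E v w)) = real (rel_degree V E v)" for v
    using finite_V by (simp add: rel_degree_def Int_def of_bool_def sum.If_cases)
  have "2 * dirichlet_form V E f = (\<Sum>v\<in>V. \<Sum>w\<in>V. of_bool (E v w) * f v + of_bool (E w v) * f w)"
    unfolding dirichlet_form_def pt by simp
  also have "\<dots> = (\<Sum>v\<in>V. rel_degree V E v * f v) + (\<Sum>w\<in>V. \<Sum>v\<in>V. of_bool (E w v) * f w)"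
    unfolding sum.distrib deg_sum[symmetric] sum_distrib_right by (subst sum.swap[of _ V V]) simp
  also have "\<dots> = 2 * (\<Sum>v\<in>V. rel_degree V E v * f v)"
    by (simp flip: deg_sum add: sum_distrib_right)
  also have "(\<Sum>v\<in>V. rel_degree V E v * f v) = (\<Sum>v\<in>I. real (rel_degree V E v))"
    using finite_V VI by (simp add: f_def Int_def of_bool_def sum.If_cases if_distrib cong: if_cong)
  finally have "dirichlet_form V E f = (\<Sum>v\<in>I. real (rel_degree V E v))" by simp
  moreover have "d * card I \<le> (\<Sum>v\<in>I. real (rel_degree V E v))"
    using sum_mono[of I "\<lambda>_. d" "\<lambda>v. real (rel_degree V E v)"] deg by (simp add: mult.commute)
  ultimately have "card V * (d * card I) \<le> card V * dirichlet_form V E f"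
    by (simp add: mult_left_mono)
  also have "\<dots> \<le> m * scaled_variance f" using I by (intro centered_upper) auto
  also have "\<dots> = m * (real (card V) - card I) * card I"
    unfolding scaled_variance_def sums by (simp add: power2_eq_square algebra_simps)
  finally have "(d * card V) * card I \<le> (m * (real (card V) - card I)) * card I"
    by (simp add: algebra_simps)
  moreover have "real (card I) > 0" using I finI by (simp add: card_gt_0_iff)
  ultimately show ?thesis by simp
qed

text \<open>The functions \<open>1\<^sub>X + 1\<^sub>Y\<close> and \<open>1\<^sub>X - 1\<^sub>Y\<close> have the same Dirichlet form; the
  bound compares their Rayleigh quotients.\<close>

lemma separation_bound_aux:
  assumes sep: "separated X Y" and le: "card X \<le> card Y" and X0: "X \<noteq> {}"
  shows "2 * l * card X \<le> (m - l) * card (V - X - Y)"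
proof -
  define x y s n where "x = real (card X)" and "y = real (card Y)"
    and "s = real (card (V - X - Y))" and "n = real (card V)"
  have XY: "X \<inter> Y = {}" "X \<subseteq> V" "Y \<subseteq> V" "\<And>v w. v \<in> X \<Longrightarrow> w \<in> Y \<Longrightarrow> \<not> E v w"
    using sep by (auto simp: separated_def)
  have n: "n = x + y + s" using cut_size[OF sep] unfolding n_def x_def y_def s_def by linarith
  have pos: "x > 0" using X0 XY finite_V unfolding x_def by (auto simp: card_gt_0_iff intro: finite_subset)
  have xy: "x \<le> y" using le by (simp add: x_def y_def)
  have s: "s \<ge> 0" by (simp add: s_def)
  define f where "f v = (of_bool (v \<in> X) + of_bool (v \<in> Y) :: real)" for v
  define g where "g v = (of_bool (v \<in> X) - of_bool (v \<in> Y) :: real)" for v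
  have sums: "(\<Sum>v\<in>V. f v) = 1 * x + 1 * y" "(\<Sum>v\<in>V. g v) = 1 * x + (-1) * y"
    "(\<Sum>v\<in>V. (f v)\<^sup>2) = 1 * x + 1 * y" "(\<Sum>v\<in>V. (g v)\<^sup>2) = 1 * x + 1 * y"
    unfolding x_def y_def by ((rule sum_piecewise[OF sep]; use XY in \<open>auto simp: f_def g_def\<close>))+
  \<comment> \<open>\<open>f\<close> and \<open>g\<close> differ only by a sign on \<open>Y\<close>,
    and no edge joins \<open>Y\<close> to \<open>X\<close>.\<close>
  have pt: "of_bool (E v w) * (f v - f w)\<^sup>2 = of_bool (E v w) * (g v - g w)\<^sup>2" for v w
    using XY(1,4) by (auto simp: f_def g_def dest: E_sym)
  have form_eq: "dirichlet_form V E f = dirichlet_form V E g"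
    unfolding dirichlet_form_def pt ..
  have "V \<noteq> {}" using X0 XY by auto
  then have "l * scaled_variance g \<le> m * scaled_variance f"
    using centered_lower[of g] centered_upper[of f] form_eq by simp
  then have main: "l * (n * (x + y) - (x - y)\<^sup>2) \<le> m * (n * (x + y) - (x + y)\<^sup>2)"
    unfolding scaled_variance_def sums by (simp flip: n_def)
  \<comment> \<open>With \<open>n = x + y + s\<close> the brackets become
    \<open>4 * x * y + s * (x + y)\<close> and \<open>s * (x + y)\<close>.\<close>
  have main2: "2 * l * (2 * x * y) \<le> (m - l) * (s * (x + y))"
    using main unfolding n by (simp add: power2_eq_square algebra_simps)
  \<comment> \<open>The sign of \<open>m - l\<close> is not given; it has to be read off from
    \<open>main2\<close> before \<open>x + y\<close> may be enlarged to
    \<open>2 * y\<close>.\<close>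
  have lm: "0 \<le> (m - l) * s"
  proof -
    have "0 \<le> 2 * l * (2 * x * y)" using l_nonneg pos xy by simp
    then have "0 \<le> ((m - l) * s) * (x + y)" using main2 by (simp add: algebra_simps)
    then show ?thesis using pos xy by (simp add: zero_le_mult_iff)
  qed
  have "(m - l) * s * (x + y) \<le> (m - l) * s * (2 * y)"
    using lm xy by (intro mult_left_mono) auto
  then have "(2 * l * x) * (2 * y) \<le> ((m - l) * s) * (2 * y)"
    using main2 by (simp add: algebra_simps)
  then have "2 * l * x \<le> (m - l) * s" by (rule mult_right_le_imp_le) (use pos xy in simp)
  then show ?thesis by (simp add: x_def s_def)
qed

text \<open>By symmetry the smaller side may be taken first. \<open>k\<close> is real so that it can
  be half of an odd number of components.\<close>

lemma separation_bound:
  fixes k :: real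
  assumes sep: "separated X Y" and k: "k \<le> card X" "k \<le> card Y" and "X \<noteq> {}" "Y \<noteq> {}"
  shows "2 * l * k \<le> (m - l) * card (V - X - Y)"
proof -
  have swap: "V - Y - X = V - X - Y" by blast
  consider "card X \<le> card Y" | "card Y \<le> card X" by linarith
  then show ?thesis
  proof cases
    case 1
    have "2 * l * k \<le> 2 * l * card X" using k l_nonneg by (intro mult_left_mono) auto
    then show ?thesis using separation_bound_aux[OF sep 1] assms by simp
  next
    case 2
    have "2 * l * k \<le> 2 * l * card Y" using k l_nonneg by (intro mult_left_mono) auto
    then show ?thesis using separation_bound_aux[OF separated_sym[OF sep] 2] assms unfolding swap by simp
  qed
qed

text \<open>Hoffman's bound for the independent set \<open>{v}\<close>: a positive \<open>d\<close>
  with \<open>d * n \<le> m * (n - 1)\<close> is below \<open>m\<close>.\<close>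

lemma degree_less_upper:
  assumes "v \<in> V" "0 < rel_degree V E v"
  shows "rel_degree V E v < m"
proof (rule ccontr)
  let ?d = "real (rel_degree V E v)"
  assume "\<not> ?d < m"
  have n: "1 \<le> real (card V)" using assms finite_V by (auto simp: Suc_le_eq card_gt_0_iff)
  have "?d * card V \<le> m * (real (card V) - card {v})"
    by (rule hoffman_bound) (use assms E_irrefl in auto)
  also have "\<dots> \<le> ?d * (real (card V) - 1)"
    using \<open>\<not> ?d < m\<close> n by (auto intro: mult_right_mono)
  finally show False using assms by (simp add: algebra_simps)
qed

text \<open>If \<open>v\<close> has neighbours, then \<open>l\<close> is at most its degree, which
  is below \<open>m\<close>. If \<open>v\<close> is isolated, then \<open>l\<close> is at most 0,
  while the positive degree of \<open>u\<close> is below \<open>m\<close>. A non-adjacent pair is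
  essential: for a complete graph on at least two vertices the two eigenvalues coincide.\<close>

lemma lower_less_upper:
  assumes "v \<in> V" "w \<in> V" "w \<noteq> v" "\<not> E v w" and u: "u \<in> V" "0 < rel_degree V E u"
  shows "l < m"
proof (cases "0 < rel_degree V E v")
  case True
  then show ?thesis
    using nonneighbour_degree_bound[OF assms(1-4)] degree_less_upper[OF assms(1)] by simp
next
  case False
  then show ?thesis
    using nonneighbour_degree_bound[OF assms(1-4)] degree_less_upper[OF u] u(2) by simp
qed

end

section \<open>Cut size against number of components\<close>

locale component_family = spectral_bounds +
  fixes \<C> :: "'a set set"
  assumes nonempty: "C \<in> \<C> \<Longrightarrow> C \<noteq> {}"
    and subset: "C \<in> \<C> \<Longrightarrow> C \<subseteq> V"
    and disjoint: "C \<in> \<C> \<Longrightarrow> D \<in> \<C> \<Longrightarrow> C \<noteq> D \<Longrightarrow> C \<inter> D = {}"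
    and no_edge: "C \<in> \<C> \<Longrightarrow> D \<in> \<C> \<Longrightarrow> C \<noteq> D \<Longrightarrow> v \<in> C \<Longrightarrow> w \<in> D \<Longrightarrow> \<not> E v w"
    and two: "2 \<le> card \<C>"
begin

lemma finite_family: "finite \<C>"
  using two card.infinite by fastforce

lemma finite_member: "C \<in> \<C> \<Longrightarrow> finite C"
  using subset finite_V finite_subset by blast

lemma separated_unions:
  assumes "\<A> \<subseteq> \<C>"
  shows "separated (\<Union>\<A>) (\<Union>(\<C> - \<A>))"
proof -
  have CD: "C \<inter> D = {}" "\<And>v w. v \<in> C \<Longrightarrow> w \<in> D \<Longrightarrow> \<not> E v w"
    if "C \<in> \<A>" "D \<in> \<C> - \<A>" for C D
  proof -
    have "C \<in> \<C>" "D \<in> \<C>" "C \<noteq> D" using that assms by auto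
    then show "C \<inter> D = {}" "\<And>v w. v \<in> C \<Longrightarrow> w \<in> D \<Longrightarrow> \<not> E v w"
      by (rule disjoint, rule no_edge)
  qed
  show ?thesis unfolding separated_def
  proof (intro conjI ballI)
    show "\<Union>\<A> \<subseteq> V" "\<Union>(\<C> - \<A>) \<subseteq> V" using assms subset by blast+
    show "\<Union>\<A> \<inter> \<Union>(\<C> - \<A>) = {}" using CD(1) by (simp add: Int_Union Int_Union2)
    show "\<not> E v w" if "v \<in> \<Union>\<A>" "w \<in> \<Union>(\<C> - \<A>)" for v w
      using that CD(2) by (elim UnionE) simp
  qed
qed

lemma cut_of_unions:
  assumes "\<A> \<subseteq> \<C>"
  shows "V - \<Union>\<A> - \<Union>(\<C> - \<A>) = V - \<Union>\<C>"
proof -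
  have "\<A> \<union> (\<C> - \<A>) = \<C>" using assms by auto
  then have "\<Union>\<A> \<union> \<Union>(\<C> - \<A>) = \<Union>\<C>" unfolding Union_Un_distrib[symmetric] by (rule arg_cong)
  then show ?thesis unfolding Diff_eq Int_assoc Compl_Un[symmetric] by (rule arg_cong)
qed

lemma card_Union_family:
  assumes "\<A> \<subseteq> \<C>"
  shows "card (\<Union>\<A>) = (\<Sum>C\<in>\<A>. card C)"
proof (rule card_Union_disjoint)
  show "pairwise disjnt \<A>" using assms disjoint unfolding pairwise_def disjnt_def by blast
qed (use assms finite_member in blast)

lemma card_Union_ge:
  assumes "\<A> \<subseteq> \<C>"
  shows "card \<A> \<le> card (\<Union>\<A>)"
proof -
  have "(\<Sum>C\<in>\<A>. 1) \<le> (\<Sum>C\<in>\<A>. card C)"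
    using assms nonempty finite_member by (intro sum_mono) (auto simp: Suc_le_eq card_gt_0_iff)
  then show ?thesis using card_Union_family[OF assms] by simp
qed

text \<open>One member against the union of all others is a separated pair, to which Fiedler's bound
  applies.\<close>

lemma connectivity_bound: "l \<le> card (V - \<Union>\<C>)"
proof -
  obtain C D where CD: "C \<in> \<C>" "D \<in> \<C>" "C \<noteq> D"
    using obtain_subset_with_card_n[OF two] by (metis card_2_iff insert_subset)
  have "l \<le> card (V - \<Union>{C} - \<Union>(\<C> - {C}))"
    by (rule fiedler_bound[OF separated_unions]) (use CD nonempty in auto)
  then show ?thesis using cut_of_unions[of "{C}"] CD by simp
qed

text \<open>A transversal of the components is an independent set.\<close>

lemma component_count_bound:
  fixes d :: real
  assumes deg: "\<And>v. v \<in> V \<Longrightarrow> d \<le> rel_degree V E v"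
  shows "d * card V \<le> m * (real (card V) - card \<C>)"
proof -
  define r where "r C = (SOME v. v \<in> C)" for C :: "'a set"
  have r: "r C \<in> C" if "C \<in> \<C>" for C
    using nonempty[OF that] unfolding r_def by (simp add: some_in_eq)
  have inj: "inj_on r \<C>"
    using r disjoint by (intro inj_onI) (metis IntI empty_iff)
  have "d * card V \<le> m * (real (card V) - card (r ` \<C>))"
  proof (rule hoffman_bound)
    show "r ` \<C> \<noteq> {}" using two by auto
    show "r ` \<C> \<subseteq> V" using r subset by blast
    then show "d \<le> rel_degree V E v" if "v \<in> r ` \<C>" for v using that deg by blast
    fix v w assume "v \<in> r ` \<C>" "w \<in> r ` \<C>"
    then obtain C D where CD: "C \<in> \<C>" "v = r C" "D \<in> \<C>" "w = r D" by blast
    show "\<not> E v w"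
    proof (cases "C = D")
      case True
      then show ?thesis using CD E_irrefl by simp
    next
      case False
      then show ?thesis unfolding CD(2,4) by (rule no_edge[OF CD(1,3) _ r[OF CD(1)] r[OF CD(3)]])
    qed
  qed
  then show ?thesis by (simp add: card_image[OF inj])
qed

text \<open>Chain the two bounds: with \<open>c\<close> components and cut \<open>S\<close>,
  \<open>m * c * l \<le> n * (m - d) * l \<le> n * (m - d) * card S\<close>.\<close>

lemma first_toughness_bound:
  fixes d :: real
  assumes deg: "\<And>v. v \<in> V \<Longrightarrow> d \<le> rel_degree V E v" and d: "d < m"
  shows "m * l / (card V * (m - d)) \<le> card (V - \<Union>\<C>) / card \<C>"
proof -
  obtain C where "C \<in> \<C>" using two by fastforce
  then have "V \<noteq> {}" using nonempty subset by blast
  then have V0: "card V > 0" using finite_V by (simp add: card_gt_0_iff)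
  have "m * card \<C> \<le> card V * (m - d)"
    using component_count_bound[OF deg] by (simp add: algebra_simps)
  then have "m * card \<C> * l \<le> card V * (m - d) * l"
    using l_nonneg by (rule mult_right_mono)
  also have "\<dots> \<le> card V * (m - d) * card (V - \<Union>\<C>)"
    using connectivity_bound d by (intro mult_left_mono) auto
  finally have "m * l * card \<C> \<le> card (V - \<Union>\<C>) * (card V * (m - d))"
    by (simp add: mult_ac)
  moreover have "0 < card V * (m - d)" "0 < real (card \<C>)" using V0 two d by auto
  ultimately show ?thesis by (simp add: pos_divide_le_eq pos_le_divide_eq mult_ac)
qed

lemma second_toughness_bound:
  assumes lm: "l < m"
  shows "l / (m - l) \<le> card (V - \<Union>\<C>) / card \<C>"
proof -
  have "l * card \<C> \<le> (m - l) * card (V - \<Union>\<C>)"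
  proof (cases "\<exists>C\<in>\<C>. 2 \<le> card C")
    case True
    then obtain C where C: "C \<in> \<C>" "2 \<le> card C" by blast
    \<comment> \<open>One side gets \<open>k\<close> components including \<open>C\<close>, the
      other side the remaining ones. The second vertex of \<open>C\<close> makes up for the
      rounding: the first side has at least \<open>k + 1\<close> vertices, hence at least half of
      \<open>card \<C>\<close> even if that number is odd.\<close>
    define k where "k = card \<C> div 2"
    have k: "1 \<le> k" "k \<le> card \<C> - 1" using two by (auto simp: k_def)
    have "k - 1 \<le> card (\<C> - {C})" using k C finite_family by simp
    then obtain \<B> where B: "\<B> \<subseteq> \<C> - {C}" "card \<B> = k - 1" "finite \<B>"
      using obtain_subset_with_card_n by metis
    define \<A> where "\<A> = insert C \<B>"
    have A: "\<A> \<subseteq> \<C>" using B C by (auto simp: \<A>_def)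
    have B': "\<B> \<subseteq> \<C>" "C \<notin> \<B>" using B by auto
    have "card (\<Union>\<A>) = card C + card (\<Union>\<B>)"
      unfolding card_Union_family[OF A] card_Union_family[OF B'(1)] using B'(2) B(3)
      by (simp add: \<A>_def)
    then have "k + 1 \<le> card (\<Union>\<A>)" using card_Union_ge[OF B'(1)] B(2) C(2) k by linarith
    then have "real (card \<C>) / 2 \<le> card (\<Union>\<A>)" unfolding k_def by linarith
    moreover have "card \<A> = k" using B k by (subst \<A>_def, subst card_insert_disjoint) auto
    then have "card (\<C> - \<A>) = card \<C> - k" using A finite_family by (simp add: card_Diff_subset finite_subset)
    then have k2: "card \<C> - k \<le> card (\<Union>(\<C> - \<A>))" using card_Union_ge[of "\<C> - \<A>"] by simp
    then have "real (card \<C>) / 2 \<le> card (\<Union>(\<C> - \<A>))" unfolding k_def by linarith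
    moreover have "\<Union>\<A> \<noteq> {}" using C nonempty by (auto simp: \<A>_def)
    moreover have "0 < card (\<Union>(\<C> - \<A>))" using k2 k by linarith
    then have "\<Union>(\<C> - \<A>) \<noteq> {}" by (metis card.empty less_irrefl)
    ultimately have "2 * l * (card \<C> / 2) \<le> (m - l) * card (V - \<Union>\<A> - \<Union>(\<C> - \<A>))"
      by (intro separation_bound[OF separated_unions[OF A]])
    then show ?thesis unfolding cut_of_unions[OF A] by simp
  next
    case False
    have single: "card C = 1" if "C \<in> \<C>" for C
    proof -
      have "0 < card C" using nonempty[OF that] finite_member[OF that] by (simp add: card_gt_0_iff)
      moreover have "\<not> 2 \<le> card C" using that False by blast
      ultimately show ?thesis by linarith
    qed
    let ?I = "\<Union>\<C>"
    have card_I: "card ?I = card \<C>" using card_Union_family[of \<C>] single by simp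
    have sub: "?I \<subseteq> V" using subset by blast
    have indep: "\<not> E v w" if "v \<in> ?I" "w \<in> ?I" for v w
    proof -
      obtain C D where CD: "v \<in> C" "C \<in> \<C>" "w \<in> D" "D \<in> \<C>" using \<open>v \<in> ?I\<close> \<open>w \<in> ?I\<close> by blast
      show ?thesis
      proof (cases "C = D")
        case True
        then have "v = w" using single[OF CD(2)] CD by (metis card_1_singletonE singletonD)
        then show ?thesis using E_irrefl by simp
      next
        case False
        then show ?thesis by (rule no_edge[OF CD(2,4) _ CD(1,3)])
      qed
    qed
    \<comment> \<open>All members are singletons. Writing \<open>card V\<close> as cut size plus
      \<open>card \<C>\<close> turns this bound into the goal.\<close>
    have "l * card V \<le> m * (real (card V) - card ?I)"
    proof (rule hoffman_bound[OF sub _ indep])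
      show "?I \<noteq> {}" using card_I two by (metis card.empty not_numeral_le_zero)
      fix v assume v: "v \<in> ?I"
      \<comment> \<open>A second vertex of the independent set is the non-neighbour that bounds the
        degree of \<open>v\<close> from below.\<close>
      have "\<not> ?I \<subseteq> {v}" using card_I two card_mono[of "{v}" ?I] by auto
      then obtain w where "w \<in> ?I" "w \<noteq> v" by blast
      then show "l \<le> rel_degree V E v" using v indep sub by (intro nonneighbour_degree_bound[of v w]) auto
    qed
    moreover have "real (card V) = card (V - ?I) + card ?I"
      using sub finite_V by (metis card_Diff_subset card_mono finite_subset le_add_diff_inverse2 of_nat_add)
    ultimately show ?thesis unfolding card_I by (simp add: algebra_simps)
  qed
  moreover have "0 < m - l" "0 < real (card \<C>)" using lm two by auto
  ultimately show ?thesis by (simp add: pos_divide_le_eq pos_le_divide_eq mult_ac)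
qed

end

subsection \<open>The Laplacian matrix and its quadratic form\<close>

text \<open>Expand the square: by symmetry of \<open>E\<close> both square terms give the degree sum
  \<open>?D\<close>, and the mixed term gives the adjacency part.\<close>

lemma dirichlet_form_eq_laplacian:
  fixes f :: "'a \<Rightarrow> real"
  assumes V: "finite V" and sym: "\<And>v w. E v w \<Longrightarrow> E w v"
  shows "dirichlet_form V E f =
    (\<Sum>v\<in>V. f v * (rel_degree V E v * f v - (\<Sum>w\<in>V. of_bool (E v w) * f w)))"
proof -
  have deg_sum: "(\<Sum>w\<in>V. of_bool (E v w)) = real (rel_degree V E v)" for v
    using V by (simp add: rel_degree_def Int_def of_bool_def sum.If_cases)
  let ?D = "\<Sum>v\<in>V. rel_degree V E v * (f v)\<^sup>2"
  let ?M = "\<Sum>v\<in>V. \<Sum>w\<in>V. of_bool (E v w) * (f v * f w)"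
  have 1: "(\<Sum>v\<in>V. \<Sum>w\<in>V. of_bool (E v w) * (f v)\<^sup>2) = ?D"
    by (simp flip: deg_sum add: sum_distrib_right)
  have 2: "(\<Sum>v\<in>V. \<Sum>w\<in>V. of_bool (E v w) * (f w)\<^sup>2) = ?D"
  proof -
    have "(\<Sum>v\<in>V. \<Sum>w\<in>V. of_bool (E v w) * (f w)\<^sup>2) = (\<Sum>w\<in>V. \<Sum>v\<in>V. of_bool (E v w) * (f w)\<^sup>2)"
      by (rule sum.swap)
    also have "\<dots> = (\<Sum>w\<in>V. \<Sum>v\<in>V. of_bool (E w v) * (f w)\<^sup>2)"
      using sym by (intro sum.cong refl) auto
    finally show ?thesis using 1 by simp
  qed
  have "2 * dirichlet_form V E f = (\<Sum>v\<in>V. \<Sum>w\<in>V. of_bool (E v w) * (f v)\<^sup>2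
      + of_bool (E v w) * (f w)\<^sup>2 - 2 * (of_bool (E v w) * (f v * f w)))"
    unfolding dirichlet_form_def by (simp add: power2_diff algebra_simps)
  also have "\<dots> = ?D + ?D - 2 * ?M"
    by (simp only: sum_subtractf sum.distrib 1 2 sum_distrib_left)
  finally have "dirichlet_form V E f = ?D - ?M" by simp
  also have "\<dots> = (\<Sum>v\<in>V. f v * (rel_degree V E v * f v - (\<Sum>w\<in>V. of_bool (E v w) * f w)))"
    by (simp add: sum_subtractf right_diff_distrib sum_distrib_left power2_eq_square mult_ac)
  finally show ?thesis .
qed

context graph
begin

text \<open>Without parallel arcs \<open>head G\<close> is injective on the arcs leaving
  \<open>v\<close>, so counting arcs is counting neighbours.\<close>

lemma out_degree_eq_rel_degree: "out_degree G v = rel_degree (verts G) (dominates G) v"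
proof -
  have "inj_on (head G) (out_arcs G v)"
    by (intro inj_onI no_multi_arcs) (auto simp: arc_to_ends_def)
  moreover have "head G ` out_arcs G v = {w \<in> verts G. v \<rightarrow>\<^bsub>G\<^esub> w}"
    by (auto simp: arcs_ends_conv)
  ultimately show ?thesis unfolding out_degree_def rel_degree_def by (metis card_image)
qed

lemma laplacian_mat_carrier: "laplacian_mat vs G \<in> carrier_mat (length vs) (length vs)"
  by (simp add: laplacian_mat_def degree_mat_def adjacency_mat_def minus_mat_def)

lemma transpose_laplacian_mat: "(laplacian_mat vs G)\<^sup>T = laplacian_mat vs G"
proof (rule eq_matI)
  have "vs ! i \<rightarrow>\<^bsub>G\<^esub> vs ! j \<longleftrightarrow> vs ! j \<rightarrow>\<^bsub>G\<^esub> vs ! i" for i j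
    using arcs_ends_symmetric[OF sym_arcs] by blast
  then show "(laplacian_mat vs G)\<^sup>T $$ (i, j) = laplacian_mat vs G $$ (i, j)"
    if "i < dim_row (laplacian_mat vs G)" "j < dim_col (laplacian_mat vs G)" for i j
    using that by (auto simp: laplacian_mat_def degree_mat_def adjacency_mat_def)
qed (auto simp: laplacian_mat_def degree_mat_def adjacency_mat_def)

section \<open>Functions on the vertices as vectors\<close>

context
  fixes vs :: "'a list"
  assumes dist: "distinct vs" and vs: "set vs = verts G"
begin

definition vec_of_fun :: "('a \<Rightarrow> real) \<Rightarrow> real vec" where
  "vec_of_fun f = vec (length vs) (\<lambda>i. f (vs ! i))"

lemma vec_of_fun_carrier [simp]: "vec_of_fun f \<in> carrier_vec (length vs)"
  by (simp add: vec_of_fun_def)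

lemma sum_nth_verts: "(\<Sum>i = 0..<length vs. g (vs ! i)) = (\<Sum>v\<in>verts G. g v)"
  by (rule sum.reindex_bij_betw, rule bij_betw_nth) (auto simp: dist vs lessThan_atLeast0)

lemma scalar_prod_vec_of_fun: "vec_of_fun f \<bullet> vec_of_fun g = (\<Sum>v\<in>verts G. f v * g v)"
  unfolding sum_nth_verts[symmetric] by (simp add: vec_of_fun_def scalar_prod_def)

lemma laplacian_mult_vec_of_fun:
  fixes f :: "'a \<Rightarrow> real"
  shows "laplacian_mat vs G *\<^sub>v vec_of_fun f = vec_of_fun (\<lambda>v. rel_degree (verts G) (dominates G) v * f v
     - (\<Sum>w\<in>verts G. of_bool (v \<rightarrow>\<^bsub>G\<^esub> w) * f w))"
proof (rule eq_vecI)
  fix i assume "i < dim_vec (vec_of_fun (\<lambda>v. rel_degree (verts G) (dominates G) v * f v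
     - (\<Sum>w\<in>verts G. of_bool (v \<rightarrow>\<^bsub>G\<^esub> w) * f w)))"
  then have i: "i < length vs" by (simp add: vec_of_fun_def)
  have "(laplacian_mat vs G *\<^sub>v vec_of_fun f) $ i =
    (\<Sum>j = 0..<length vs. (if i = j then real (out_degree G (vs ! i)) else 0) * f (vs ! j))
    - (\<Sum>j = 0..<length vs. of_bool (vs ! i \<rightarrow>\<^bsub>G\<^esub> vs ! j) * f (vs ! j))"
    using i by (simp add: laplacian_mat_def degree_mat_def adjacency_mat_def vec_of_fun_def
        scalar_prod_def left_diff_distrib sum_subtractf of_bool_def)
  also have "(\<Sum>j = 0..<length vs. (if i = j then real (out_degree G (vs ! i)) else 0) * f (vs ! j))
    = out_degree G (vs ! i) * f (vs ! i)"
    using i by (subst sum.remove[of _ i]) auto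
  also have "(\<Sum>j = 0..<length vs. of_bool (vs ! i \<rightarrow>\<^bsub>G\<^esub> vs ! j) * f (vs ! j))
    = (\<Sum>w\<in>verts G. of_bool (vs ! i \<rightarrow>\<^bsub>G\<^esub> w) * f w)"
    by (rule sum_nth_verts)
  finally show "(laplacian_mat vs G *\<^sub>v vec_of_fun f) $ i =
    vec_of_fun (\<lambda>v. rel_degree (verts G) (dominates G) v * f v
     - (\<Sum>w\<in>verts G. of_bool (v \<rightarrow>\<^bsub>G\<^esub> w) * f w)) $ i"
    using i by (simp add: vec_of_fun_def out_degree_eq_rel_degree)
qed (simp add: vec_of_fun_def laplacian_mat_def degree_mat_def adjacency_mat_def)

lemma laplacian_quadratic_form:
  "vec_of_fun f \<bullet> (laplacian_mat vs G *\<^sub>v vec_of_fun f) = dirichlet_form (verts G) (dominates G) f"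
  unfolding laplacian_mult_vec_of_fun scalar_prod_vec_of_fun
  by (rule dirichlet_form_eq_laplacian[symmetric]) (auto intro: arcs_ends_symmetric[OF sym_arcs])

lemma vec_of_fun_surj:
  assumes "x \<in> carrier_vec (length vs)"
  obtains f where "x = vec_of_fun f"
proof -
  define f where "f v = x $ (the_inv_into {..<length vs} ((!) vs) v)" for v
  have "inj_on ((!) vs) {..<length vs}" using dist by (simp add: inj_on_nth)
  then have "x = vec_of_fun f"
    using assms by (intro eq_vecI) (auto simp: vec_of_fun_def f_def the_inv_into_f_f)
  then show thesis by (rule that)
qed

text \<open>The constant vector lies in the kernel of the Laplacian, and orthogonality to it means
  sum zero; so the Rayleigh bounds become the locale assumptions.\<close>

lemma laplacian_spectral_bounds:
  assumes "2 \<le> length vs"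
  shows "spectral_bounds (verts G) (dominates G)
    (ith_eigenvalue (laplacian_mat vs G) 2) (ith_eigenvalue (laplacian_mat vs G) (length vs))"
proof -
  let ?L = "laplacian_mat vs G" and ?n = "length vs"
  note L = laplacian_mat_carrier[of vs] and sym = transpose_laplacian_mat[of vs]
  have psd: "0 \<le> x \<bullet> (?L *\<^sub>v x)" if x: "x \<in> carrier_vec ?n" for x
  proof -
    obtain f where "x = vec_of_fun f" by (rule vec_of_fun_surj[OF x])
    then show ?thesis by (simp add: laplacian_quadratic_form dirichlet_form_def sum_nonneg)
  qed
  let ?w = "vec_of_fun (\<lambda>_. 1)"
  have Lw: "?L *\<^sub>v ?w = 0\<^sub>v ?n"
  proof -
    have "(\<Sum>w\<in>verts G. of_bool (v \<rightarrow>\<^bsub>G\<^esub> w)) = real (rel_degree (verts G) (dominates G) v)" for v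
      by (simp add: rel_degree_def Int_def of_bool_def sum.If_cases)
    then show ?thesis unfolding laplacian_mult_vec_of_fun by (auto simp: vec_of_fun_def)
  qed
  have w0: "?w \<noteq> 0\<^sub>v ?n"
  proof
    assume eq: "?w = 0\<^sub>v ?n"
    have "0 < ?n" using assms by linarith
    then have "?w $ 0 = 1" by (simp add: vec_of_fun_def)
    moreover have "?w $ 0 = 0" unfolding eq using \<open>0 < ?n\<close> by simp
    ultimately show False by simp
  qed
  show ?thesis
  proof
    show "v \<rightarrow>\<^bsub>G\<^esub> w \<Longrightarrow> w \<rightarrow>\<^bsub>G\<^esub> v" for v w by (rule arcs_ends_symmetric[OF sym_arcs])
    show "\<not> v \<rightarrow>\<^bsub>G\<^esub> v" for v using adj_not_same by blast
    show "0 \<le> ith_eigenvalue ?L 2"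
      using psd_ith_eigenvalue_nonneg[OF L sym psd, of 1] assms by (simp add: numeral_2_eq_2)
    fix f :: "'a \<Rightarrow> real"
    show "dirichlet_form (verts G) (dominates G) f \<le> ith_eigenvalue ?L ?n * (\<Sum>v\<in>verts G. (f v)\<^sup>2)"
      using rayleigh_upper_bound[OF L sym vec_of_fun_carrier[of f]]
      by (simp add: laplacian_quadratic_form scalar_prod_vec_of_fun power2_eq_square)
    assume "(\<Sum>v\<in>verts G. f v) = 0"
    then have "vec_of_fun f \<bullet> ?w = 0" by (simp add: scalar_prod_vec_of_fun)
    then show "ith_eigenvalue ?L 2 * (\<Sum>v\<in>verts G. (f v)\<^sup>2) \<le> dirichlet_form (verts G) (dominates G) f"
      using rayleigh_lower_bound[OF L sym assms psd vec_of_fun_carrier w0 Lw vec_of_fun_carrier[of f]]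
      by (simp add: laplacian_quadratic_form scalar_prod_vec_of_fun power2_eq_square)
  qed simp
qed

end

section \<open>Connected components of induced subgraphs\<close>

text \<open>Supplies the data of a \<open>component_family\<close>. An arc of \<open>G\<close>
  inside \<open>U\<close> survives in the induced subgraph, and by symmetry its ends reach each
  other there, so they share a component.\<close>

lemma induced_sccs_verts:
  assumes "U \<subseteq> verts G"
  defines "\<C> \<equiv> pre_digraph.sccs_verts (G \<restriction> U)"
  shows "card \<C> = num_components (G \<restriction> U)" "\<Union>\<C> = U"
    "\<And>C. C \<in> \<C> \<Longrightarrow> C \<noteq> {}"
    "\<And>C D. C \<in> \<C> \<Longrightarrow> D \<in> \<C> \<Longrightarrow> C \<noteq> D \<Longrightarrow> C \<inter> D = {}"
    "\<And>C D v w. C \<in> \<C> \<Longrightarrow> D \<in> \<C> \<Longrightarrow> C \<noteq> D \<Longrightarrow> v \<in> C \<Longrightarrow> w \<in> D \<Longrightarrow> \<not> v \<rightarrow>\<^bsub>G\<^esub> w"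
proof -
  have ind: "induced_subgraph (G \<restriction> U) G" using assms(1) by (rule induced_induce)
  interpret H: wf_digraph "G \<restriction> U" by (rule wellformed_induce_subgraph)
  interpret H: sym_digraph "G \<restriction> U"
    using induced_graph_imp_symmetric[OF sym_arcs ind] by unfold_locales
  show "card \<C> = num_components (G \<restriction> U)"
    unfolding \<C>_def num_components_def by (rule H.card_sccs_verts)
  show U: "\<Union>\<C> = U"
    unfolding \<C>_def using H.sccs_verts_subsets H.scc_of_in_sccs_verts H.in_scc_of_self by fastforce
  show "\<And>C. C \<in> \<C> \<Longrightarrow> C \<noteq> {}"
    unfolding \<C>_def by (simp add: H.in_sccs_verts_conv_reachable)
  show disj: "\<And>C D. C \<in> \<C> \<Longrightarrow> D \<in> \<C> \<Longrightarrow> C \<noteq> D \<Longrightarrow> C \<inter> D = {}"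
    unfolding \<C>_def by (rule H.sccs_verts_disjoint)
  fix C D v w assume CD: "C \<in> \<C>" "D \<in> \<C>" "C \<noteq> D" "v \<in> C" "w \<in> D"
  show "\<not> v \<rightarrow>\<^bsub>G\<^esub> w"
  proof
    assume "v \<rightarrow>\<^bsub>G\<^esub> w"
    moreover have "v \<in> U" "w \<in> U" using U CD by blast+
    ultimately have vw: "v \<rightarrow>\<^bsub>G \<restriction> U\<^esub> w" by (auto simp: arcs_ends_conv)
    then have "v \<rightarrow>\<^sup>*\<^bsub>G \<restriction> U\<^esub> w" by (rule H.reachable_adjI)
    moreover from this have "w \<rightarrow>\<^sup>*\<^bsub>G \<restriction> U\<^esub> v" by (rule symmetric_reachable[OF H.sym_arcs])
    moreover have "w \<notin> C" using disj[OF CD(1-3)] CD(5) by blast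
    ultimately show False using CD(1,4) unfolding \<C>_def H.in_sccs_verts_conv_reachable by blast
  qed
qed

text \<open>Shows that a graph which is not complete has an admissible cut. A walk from
  \<open>u\<close> to \<open>v\<close> inside the pair would need a first arc, leading to
  \<open>u\<close> or to \<open>v\<close>, and neither exists.\<close>

lemma num_components_nonadjacent_pair:
  assumes uv: "u \<in> verts G" "v \<in> verts G" "u \<noteq> v" "\<not> u \<rightarrow>\<^bsub>G\<^esub> v"
  shows "1 < num_components (G \<restriction> {u, v})"
proof -
  have UV: "{u, v} \<subseteq> verts G" using uv by simp
  define \<C> where "\<C> = pre_digraph.sccs_verts (G \<restriction> {u, v})"
  note C = induced_sccs_verts[OF UV, folded \<C>_def]
  interpret H: wf_digraph "G \<restriction> {u, v}" by (rule wellformed_induce_subgraph)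
  have fin: "finite \<C>" by (rule finite_UnionD) (simp add: C(2))
  have nonreach: "\<not> u \<rightarrow>\<^sup>*\<^bsub>G \<restriction> {u, v}\<^esub> v"
  proof
    assume "u \<rightarrow>\<^sup>*\<^bsub>G \<restriction> {u, v}\<^esub> v"
    then show False
    proof (cases rule: H.converse_reachable_cases)
      case base
      then show False using uv by simp
    next
      case (step w)
      then have "u \<rightarrow>\<^bsub>G\<^esub> w" by (rule_tac dominates_induce_subgraphD)
      moreover have "w \<in> {u, v}" using H.adj_in_verts[OF step(1)] by simp
      ultimately show False using uv adj_not_same by blast
    qed
  qed
  obtain A B where AB: "A \<in> \<C>" "u \<in> A" "B \<in> \<C>" "v \<in> B" using C(2) by blast
  have "A \<noteq> B"
    using nonreach AB unfolding \<C>_def H.in_sccs_verts_conv_reachable by blast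
  then have "card {A, B} = 2" by simp
  moreover have "card {A, B} \<le> card \<C>" using AB fin by (intro card_mono) auto
  ultimately show ?thesis using C(1) by simp
qed

end

subsection \<open>Toughness\<close>

text \<open>For a complete graph the toughness is infinite. Otherwise the minimum is over a finite
  nonempty set and is attained. The non-adjacent pair is handed on because strictness of
  \<open>\<mu> 2 < \<mu> n\<close> depends on it.\<close>

lemma toughness_geI:
  assumes G: "graph G"
    and bound: "\<And>u v S. u \<in> verts G \<Longrightarrow> v \<in> verts G \<Longrightarrow> u \<noteq> v \<Longrightarrow> \<not> u \<rightarrow>\<^bsub>G\<^esub> v \<Longrightarrow> S \<subset> verts G \<Longrightarrow>
      1 < num_components (G \<restriction> (verts G - S)) \<Longrightarrow>
      b \<le> ereal (real (card S) / real (num_components (G \<restriction> (verts G - S))))"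
  shows "b \<le> toughness G"
proof (cases "complete_digraph (card (verts G)) G")
  case True
  then show ?thesis by (simp add: toughness_def)
next
  case False
  interpret graph G by (rule G)
  obtain u v where uv: "u \<in> verts G" "v \<in> verts G" "u \<noteq> v" "\<not> u \<rightarrow>\<^bsub>G\<^esub> v"
    using False G adj_not_same adj_in_verts unfolding complete_digraph_def by auto
  let ?P = "\<lambda>S. S \<subset> verts G \<and> 1 < num_components (G \<restriction> (verts G - S))"
  let ?f = "\<lambda>S. real (card S) / real (num_components (G \<restriction> (verts G - S)))"
  have eq: "toughness G = ereal (Min (?f ` {S. ?P S}))"
    unfolding toughness_def using False by (simp add: setcompr_eq_image)
  have "verts G - (verts G - {u, v}) = {u, v}" using uv by auto
  \<comment> \<open>Removing everything but \<open>u\<close> and \<open>v\<close> is admissible, so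
    \<open>Min\<close> is not applied to an empty set.\<close>
  then have "?P (verts G - {u, v})" using num_components_nonadjacent_pair[OF uv] uv by auto
  then have "?f ` {S. ?P S} \<noteq> {}" by blast
  moreover have "finite {S. ?P S}" by (rule finite_subset[of _ "Pow (verts G)"]) auto
  ultimately have "Min (?f ` {S. ?P S}) \<in> ?f ` {S. ?P S}" by (intro Min_in) auto
  then obtain S where "?P S" "Min (?f ` {S. ?P S}) = ?f S" by blast
  then show ?thesis unfolding eq using bound[OF uv, of S] by simp
qed

theorem theorem1:
  fixes G :: "('a, 'b) pre_digraph"
    and vs :: "'a list"
    and n \<delta> :: nat
    and \<mu> :: "nat \<Rightarrow> real"
  assumes "graph G"
    and "arcs G \<noteq> {}"
    and "distinct vs" and "set vs = verts G"
    and "n = card (verts G)"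
    and "\<delta> = min_degree G"
    and "\<mu> = ith_eigenvalue (laplacian_mat vs G)"
  shows "toughness G \<ge> ereal (\<mu> n * \<mu> 2) / ereal (real n * (\<mu> n - real \<delta>)) \<and>
    toughness G \<ge> ereal (\<mu> 2) / ereal (\<mu> n - \<mu> 2)"
proof -
  interpret graph G by (rule assms(1))
  let ?deg = "rel_degree (verts G) (dominates G)"
  have n: "n = length vs" using assms(3-5) distinct_card by metis
  obtain x y where xy: "x \<rightarrow>\<^bsub>G\<^esub> y" using assms(2) by (auto simp: arcs_ends_conv)
  then have xyV: "x \<in> verts G" "y \<in> verts G" "x \<noteq> y" using adj_in_verts adj_not_same by blast+
  have "card {x, y} \<le> card (verts G)" using xyV by (intro card_mono) auto
  \<comment> \<open>The ends of one arc are two vertices, so a second eigenvalue exists.\<close>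
  then have "2 \<le> n" using xyV(3) assms(5) by simp
  then interpret spectral_bounds "verts G" "dominates G" "\<mu> 2" "\<mu> n"
    unfolding assms(7) n using laplacian_spectral_bounds[OF assms(3,4)] by simp
  have "y \<in> {w \<in> verts G. x \<rightarrow>\<^bsub>G\<^esub> w}" using xy xyV by simp
  then have x: "0 < ?deg x" unfolding rel_degree_def by (subst card_gt_0_iff) auto
  have \<delta>: "\<delta> \<le> ?deg v" if "v \<in> verts G" for v
    unfolding assms(6) min_degree_def out_degree_eq_rel_degree[symmetric] using that by (intro Min_le) auto
  have \<delta>_less: "\<delta> < \<mu> n"
    using degree_less_upper[OF xyV(1) x] \<delta>[OF xyV(1)] by linarith
  have family: "component_family (verts G) (dominates G) (\<mu> 2) (\<mu> n)
      (pre_digraph.sccs_verts (G \<restriction> (verts G - S)))"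
    if "1 < num_components (G \<restriction> (verts G - S))" for S
  proof
    let ?C = "pre_digraph.sccs_verts (G \<restriction> (verts G - S))"
    note C = induced_sccs_verts[OF Diff_subset[of "verts G" S]]
    show "2 \<le> card ?C" using C(1) that by simp
    show "C \<subseteq> verts G" if "C \<in> ?C" for C using C(2) that by blast
    show "C \<noteq> {}" if "C \<in> ?C" for C using C(3) that .
    show "C \<inter> D = {}" if "C \<in> ?C" "D \<in> ?C" "C \<noteq> D" for C D using C(4) that .
    show "\<not> v \<rightarrow>\<^bsub>G\<^esub> w" if "C \<in> ?C" "D \<in> ?C" "C \<noteq> D" "v \<in> C" "w \<in> D" for C D v w using C(5) that .
  qed
  have cut: "verts G - \<Union>(pre_digraph.sccs_verts (G \<restriction> (verts G - S))) = S"
    and count: "card (pre_digraph.sccs_verts (G \<restriction> (verts G - S))) = num_components (G \<restriction> (verts G - S))"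
    if "S \<subset> verts G" for S
    using induced_sccs_verts(1,2)[OF Diff_subset[of "verts G" S]] that by auto
  have "ereal (\<mu> n * \<mu> 2) / ereal (real n * (\<mu> n - real \<delta>)) \<le> toughness G"
  proof (rule toughness_geI[OF assms(1)])
    fix S assume S: "S \<subset> verts G" "1 < num_components (G \<restriction> (verts G - S))"
    \<comment> \<open>With a nonzero denominator the extended real quotient is the real one.\<close>
    have "real n * (\<mu> n - real \<delta>) \<noteq> 0" using \<open>2 \<le> n\<close> \<delta>_less by simp
    then show "ereal (\<mu> n * \<mu> 2) / ereal (real n * (\<mu> n - real \<delta>))
        \<le> ereal (real (card S) / real (num_components (G \<restriction> (verts G - S))))"
      using component_family.first_toughness_bound[OF family[OF S(2)], of \<delta>] \<delta> \<delta>_less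
      by (simp add: cut count S(1) assms(5))
  qed
  moreover have "ereal (\<mu> 2) / ereal (\<mu> n - \<mu> 2) \<le> toughness G"
  proof (rule toughness_geI[OF assms(1)])
    fix u v S assume uv: "u \<in> verts G" "v \<in> verts G" "u \<noteq> v" "\<not> u \<rightarrow>\<^bsub>G\<^esub> v"
      and S: "S \<subset> verts G" "1 < num_components (G \<restriction> (verts G - S))"
    \<comment> \<open>The pair \<open>u\<close>, \<open>v\<close> supplies the missing edge and
      \<open>x\<close> the vertex of positive degree, which keeps the second denominator
      positive.\<close>
    have "\<mu> 2 < \<mu> n" using lower_less_upper[OF uv(1,2) uv(3)[symmetric] uv(4) xyV(1) x] .
    then show "ereal (\<mu> 2) / ereal (\<mu> n - \<mu> 2)
        \<le> ereal (real (card S) / real (num_components (G \<restriction> (verts G - S))))"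
      using component_family.second_toughness_bound[OF family[OF S(2)]]
      by (simp add: cut count S(1))
  qed
  ultimately show ?thesis by blast
qed

end
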